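(* Let $\boldsymbol\lambda=(\lambda_c,\lambda_d)^\top\in\mathbb R_+^2$. Let $(\boldsymbol\theta^*,\mathbf f^*,\mathbf p^*,\mathbf u^* )$ be an optimal solution to the original problem (Battery) and $(\hat{\boldsymbol\theta},\hat{\mathbf f},\hat{\mathbf p},\hat{\mathbf u})$ an optimal solution to the regularized problem (Reg-Battery) with regularizer $(\lambda_c,\lambda_d)$. Then $$c(\hat{\mathbf p})-c(\mathbf p^* )\le T\,N_b\,\max\{E_c^{\max}\lambda_c,\ E_d^{\max}\lambda_d\}.$$
   Context: Data. $\mathcal N$ is a finite set of buses, $\mathcal L\subseteq\mathcal N\times\mathcal N$ a finite set of transmission lines, $\mathcal N_b\subseteq\mathcal N$ the set of buses carrying a battery, $\mathcal T=\{1,\dots,T\}$ the time periods, $N=|\mathcal N|$, $N_b=|\mathcal N_b|$. For $i\in\mathcal N$, $\delta_i^+=\{j:(i,j)\in\mathcal L\}$ and $\delta_i^-=\{j:(j,i)\in\mathcal L\}$. Real parameters: $0\le G_i^{\min}\le G_i^{\max}$ ($i\in\mathcal N$), $F_{ij}\ge0$ and $B_{ij}$ ($(i,j)\in\mathcal L$), demands $D_{t,i}$, $0\le E^{\min}\le E^{\max}$, $0\le E_c^{\min}\le E_c^{\max}$, $0\le E_d^{\min}\le E_d^{\max}$, initial state-of-charge $E_0$, and efficiencies $\eta_c,\eta_d\in(0,1]$. Variables (indexed by $t\in\mathcal T$): phase angles $\theta_{t,i}$, flows $f_{t,ij}$, $\mathbf p=(\mathbf p^g,\mathbf p^s,\mathbf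 p^c,\mathbf p^d,\mathbf p^{ls},\mathbf p^{ex})$ (generation, state-of-charge, charging, discharging, load shedding, excess power; $p^s$ also has components $p^s_{0,i}$), and $u_{t,i}$. Operational constraints: - $G_i^{\min}\le p^g_{t,i}\le G_i^{\max}$ for all $t\in\mathcal T,i\in\mathcal N$; - $-F_{ij}\le f_{t,ij}\le F_{ij}$ and $f_{t,ij}=B_{ij}(\theta_{t,i}-\theta_{t,j})$ for all $t\in\mathcal T,(i,j)\in\mathcal L$; - for $t\in\mathcal T,i\in\mathcal N_b$: $E_c^{\min}u_{t,i}\le p^c_{t,i}\le E_c^{\max}u_{t,i}$; $E_d^{\min}(1-u_{t,i})\le p^d_{t,i}\le E_d^{\max}(1-u_{t,i})$; $p^s_{t,i}=p^s_{t-1,i}+\eta_c p^c_{t,i}-\frac1{\eta_d}p^d_{t,i}$; $p^s_{0,i}=E_0$; $E^{\min}\le p^s_{t,i}\le E^{\max}$; - for $t\in\mathcal T,i\in\mathcal N\setminus\mathcal N_b$: $p^s_{t,i}=p^s_{0,i}=p^c_{t,i}=p^d_{t,i}=u_{t,i}=0$; - $p^{ls}_{t,i}\ge0$, $p^{ex}_{t,i}\ge0$ for all $t\in\mathcal T,i\in\mathcal N$; - $\sum_{j\in\delta_i^+}f_{t,ij}-\sum_{j\in\delta_i^-}f_{t,ji}=p^g_{t,i}-D_{t,i}-p^c_{t,i}+p^d_{t,i}+p^{ls}_{t,i}-p^{ex}_{t,i}$ for all $t\in\mathcal T,i\in\mathcal N$. Objective: $c(\mathbf p)=c^g(\mathbf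 p^g)+\sum_{t\in\mathcal T}\sum_{i\in\mathcal N}(p^{ls}_{t,i}+p^{ex}_{t,i})$, where $c^g$ is a real-valued generator cost function (usually linear or convex quadratic), and $g(\mathbf p)=\left(\sum_{t\in\mathcal T}\sum_{i\in\mathcal N}p^c_{t,i},\ \sum_{t\in\mathcal T}\sum_{i\in\mathcal N}p^d_{t,i}\right)^\top$. The original problem (Battery) is to minimize $c(\mathbf p)$ over all $(\boldsymbol\theta,\mathbf f,\mathbf p,\mathbf u)$ satisfying the operational constraints and $\mathbf u\in\{0,1\}^{T\times N}$. The regularized problem (Reg-Battery) with regularizer $\boldsymbol\lambda\in\mathbb R_+^2$ is to minimize $c(\mathbf p)+\boldsymbol\lambda^\top g(\mathbf p)$ over the same set. *)

theory Defs
  imports "HOL-Analysis.Analysis"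
begin

record 'n battery_data =
  buses :: "'n set"
  lines :: "('n \<times> 'n) set"
  batteries :: "'n set"
  horizon :: nat
  gen_min :: "'n \<Rightarrow> real"
  gen_max :: "'n \<Rightarrow> real"
  flow_cap :: "'n \<times> 'n \<Rightarrow> real"
  susceptance :: "'n \<times> 'n \<Rightarrow> real"
  demand :: "nat \<times> 'n \<Rightarrow> real"
  soc_min :: real
  soc_max :: real
  charge_min :: real
  charge_max :: real
  discharge_min :: real
  discharge_max :: real
  soc_init :: real
  charge_eff :: real
  discharge_eff :: real
  gen_cost :: "(nat \<times> 'n \<Rightarrow> real) \<Rightarrow> real"

definition periods :: "'n battery_data \<Rightarrow> nat set" where
  "periods d = {1..horizon d}"

definition out_nbrs :: "'n battery_data \<Rightarrow> 'n \<Rightarrow> 'n set" where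
  "out_nbrs d i = {j. (i, j) \<in> lines d}"

definition in_nbrs :: "'n battery_data \<Rightarrow> 'n \<Rightarrow> 'n set" where
  "in_nbrs d i = {j. (j, i) \<in> lines d}"

definition valid_data :: "'n battery_data \<Rightarrow> bool" where
  "valid_data d \<longleftrightarrow>
     finite (buses d) \<and> lines d \<subseteq> buses d \<times> buses d \<and> batteries d \<subseteq> buses d \<and>
     (\<forall>i\<in>buses d. 0 \<le> gen_min d i \<and> gen_min d i \<le> gen_max d i) \<and>
     (\<forall>l\<in>lines d. 0 \<le> flow_cap d l) \<and>
     0 \<le> soc_min d \<and> soc_min d \<le> soc_max d \<and>
     0 \<le> charge_min d \<and> charge_min d \<le> charge_max d \<and>
     0 \<le> discharge_min d \<and> discharge_min d \<le> discharge_max d \<and>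
     charge_eff d \<in> {0<..1} \<and> discharge_eff d \<in> {0<..1}"

text \<open>Generation, state of charge, charging, discharging, load shedding and excess power.\<close>

record 'n powers =
  pg :: "nat \<times> 'n \<Rightarrow> real"
  ps :: "nat \<times> 'n \<Rightarrow> real"
  pc :: "nat \<times> 'n \<Rightarrow> real"
  pd :: "nat \<times> 'n \<Rightarrow> real"
  pls :: "nat \<times> 'n \<Rightarrow> real"
  pex :: "nat \<times> 'n \<Rightarrow> real"

record 'n solution =
  angle :: "nat \<times> 'n \<Rightarrow> real"
  flow :: "nat \<times> 'n \<times> 'n \<Rightarrow> real"
  powers_of :: "'n powers"
  mode :: "nat \<times> 'n \<Rightarrow> real"

text \<open>A vector in \<open>\<real>\<^sup>I\<close> is an extensional function in \<open>I \<rightarrow>\<^sub>E UNIV\<close>. This matters for the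
  generator cost, an arbitrary function of the whole vector: it must not see
  components outside the index set. Only the state of charge has components at time 0.\<close>

definition decision_space :: "'n battery_data \<Rightarrow> 'n solution set" where
  "decision_space d = {s.
     angle s \<in> periods d \<times> buses d \<rightarrow>\<^sub>E UNIV \<and>
     flow s \<in> periods d \<times> lines d \<rightarrow>\<^sub>E UNIV \<and>
     pg (powers_of s) \<in> periods d \<times> buses d \<rightarrow>\<^sub>E UNIV \<and>
     ps (powers_of s) \<in> {0..horizon d} \<times> buses d \<rightarrow>\<^sub>E UNIV \<and>
     pc (powers_of s) \<in> periods d \<times> buses d \<rightarrow>\<^sub>E UNIV \<and>
     pd (powers_of s) \<in> periods d \<times> buses d \<rightarrow>\<^sub>E UNIV \<and>
     pls (powers_of s) \<in> periods d \<times> buses d \<rightarrow>\<^sub>E UNIV \<and>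
     pex (powers_of s) \<in> periods d \<times> buses d \<rightarrow>\<^sub>E UNIV \<and>
     mode s \<in> periods d \<times> buses d \<rightarrow>\<^sub>E UNIV}"

definition generation_constraints :: "'n battery_data \<Rightarrow> 'n solution \<Rightarrow> bool" where
  "generation_constraints d s \<longleftrightarrow>
     (\<forall>t\<in>periods d. \<forall>i\<in>buses d.
        gen_min d i \<le> pg (powers_of s) (t, i) \<and> pg (powers_of s) (t, i) \<le> gen_max d i)"

definition flow_constraints :: "'n battery_data \<Rightarrow> 'n solution \<Rightarrow> bool" where
  "flow_constraints d s \<longleftrightarrow>
     (\<forall>t\<in>periods d. \<forall>(i, j)\<in>lines d.
        - flow_cap d (i, j) \<le> flow s (t, i, j) \<and> flow s (t, i, j) \<le> flow_cap d (i, j) \<and>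
        flow s (t, i, j) = susceptance d (i, j) * (angle s (t, i) - angle s (t, j)))"

definition battery_constraints :: "'n battery_data \<Rightarrow> 'n solution \<Rightarrow> bool" where
  "battery_constraints d s \<longleftrightarrow> (let p = powers_of s; u = mode s in
     (\<forall>t\<in>periods d. \<forall>i\<in>batteries d.
        charge_min d * u (t, i) \<le> pc p (t, i) \<and> pc p (t, i) \<le> charge_max d * u (t, i) \<and>
        discharge_min d * (1 - u (t, i)) \<le> pd p (t, i) \<and>
        pd p (t, i) \<le> discharge_max d * (1 - u (t, i)) \<and>
        ps p (t, i) = ps p (t - 1, i) + charge_eff d * pc p (t, i)
                        - 1 / discharge_eff d * pd p (t, i) \<and>
        ps p (0, i) = soc_init d \<and>
        soc_min d \<le> ps p (t, i) \<and> ps p (t, i) \<le> soc_max d))"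

definition no_battery_constraints :: "'n battery_data \<Rightarrow> 'n solution \<Rightarrow> bool" where
  "no_battery_constraints d s \<longleftrightarrow> (let p = powers_of s; u = mode s in
     (\<forall>t\<in>periods d. \<forall>i\<in>buses d - batteries d.
        ps p (t, i) = 0 \<and> ps p (0, i) = 0 \<and> pc p (t, i) = 0 \<and> pd p (t, i) = 0 \<and> u (t, i) = 0))"

definition slack_constraints :: "'n battery_data \<Rightarrow> 'n solution \<Rightarrow> bool" where
  "slack_constraints d s \<longleftrightarrow>
     (\<forall>t\<in>periods d. \<forall>i\<in>buses d. 0 \<le> pls (powers_of s) (t, i) \<and> 0 \<le> pex (powers_of s) (t, i))"

definition balance_constraints :: "'n battery_data \<Rightarrow> 'n solution \<Rightarrow> bool" where
  "balance_constraints d s \<longleftrightarrow> (let p = powers_of s in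
     (\<forall>t\<in>periods d. \<forall>i\<in>buses d.
        (\<Sum>j\<in>out_nbrs d i. flow s (t, i, j)) - (\<Sum>j\<in>in_nbrs d i. flow s (t, j, i)) =
        pg p (t, i) - demand d (t, i) - pc p (t, i) + pd p (t, i) + pls p (t, i) - pex p (t, i)))"

definition operational_constraints :: "'n battery_data \<Rightarrow> 'n solution \<Rightarrow> bool" where
  "operational_constraints d s \<longleftrightarrow>
     generation_constraints d s \<and> flow_constraints d s \<and> battery_constraints d s \<and>
     no_battery_constraints d s \<and> slack_constraints d s \<and> balance_constraints d s"

definition feasible :: "'n battery_data \<Rightarrow> 'n solution \<Rightarrow> bool" where
  "feasible d s \<longleftrightarrow>
     s \<in> decision_space d \<and> operational_constraints d s \<and>
     (\<forall>t\<in>periods d. \<forall>i\<in>buses d. mode s (t, i) \<in> {0, 1})"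

definition total_cost :: "'n battery_data \<Rightarrow> 'n powers \<Rightarrow> real" where
  "total_cost d p =
     gen_cost d (pg p) + (\<Sum>t\<in>periods d. \<Sum>i\<in>buses d. pls p (t, i) + pex p (t, i))"

definition throughput :: "'n battery_data \<Rightarrow> 'n powers \<Rightarrow> real \<times> real" where
  "throughput d p =
     (\<Sum>t\<in>periods d. \<Sum>i\<in>buses d. pc p (t, i), \<Sum>t\<in>periods d. \<Sum>i\<in>buses d. pd p (t, i))"

definition optimal_battery :: "'n battery_data \<Rightarrow> 'n solution \<Rightarrow> bool" where
  "optimal_battery d = is_arg_min (\<lambda>s. total_cost d (powers_of s)) (feasible d)"

definition optimal_reg_battery :: "'n battery_data \<Rightarrow> real \<times> real \<Rightarrow> 'n solution \<Rightarrow> bool" where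
  "optimal_reg_battery d lam =
     is_arg_min (\<lambda>s. total_cost d (powers_of s) + lam \<bullet> throughput d (powers_of s)) (feasible d)"

end

theory Submission
  imports Defs
begin

text \<open>The penalty of a feasible solution lies between \<open>0\<close> and the stated bound, because a battery
  charges or discharges in each period but never does both. Comparing \<open>s_hat\<close> with \<open>s_star\<close>
  in the regularized problem bounds the cost gap by the difference of their penalties.\<close>

lemma feasible_battery_penalty_bounds:
  fixes lam_c lam_d :: real
  assumes valid: "valid_data d" and lam: "0 \<le> lam_c" "0 \<le> lam_d"
    and feas: "feasible d s" and t: "t \<in> periods d" and i: "i \<in> batteries d"
  defines "r \<equiv> lam_c * pc (powers_of s) (t, i) + lam_d * pd (powers_of s) (t, i)"
  shows "0 \<le> r" and "r \<le> max (charge_max d * lam_c) (discharge_max d * lam_d)"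
proof -
  let ?c = "pc (powers_of s) (t, i)" and ?e = "pd (powers_of s) (t, i)" and ?u = "mode s (t, i)"
  \<comment> \<open>Integrality of \<open>mode\<close> is imposed on \<open>buses d\<close>; this
    inclusion makes it available at \<open>i\<close>.\<close>
  have "i \<in> buses d" using valid i by (auto simp: valid_data_def)
  then have u: "?u = 0 \<or> ?u = 1" using feas t by (auto simp: feasible_def)
  have b: "charge_min d * ?u \<le> ?c" "?c \<le> charge_max d * ?u"
    "discharge_min d * (1 - ?u) \<le> ?e" "?e \<le> discharge_max d * (1 - ?u)"
    using feas t i
    by (auto simp: feasible_def operational_constraints_def battery_constraints_def Let_def)
  have min_nonneg: "0 \<le> charge_min d" "0 \<le> discharge_min d"
    using valid by (auto simp: valid_data_def)
  \<comment> \<open>If \<open>?u = 1\<close>, the discharge limits collapse to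
    \<open>?e = 0\<close>; if \<open>?u = 0\<close>, the charge limits collapse to
    \<open>?c = 0\<close>. Only one term of \<open>r\<close> survives, hence a maximum of the two
    weighted capacities rather than their sum.\<close>
  from u have "0 \<le> ?c \<and> 0 \<le> ?e \<and> (?c \<le> charge_max d \<and> ?e = 0 \<or> ?c = 0 \<and> ?e \<le> discharge_max d)"
    using b min_nonneg by auto
  then show "0 \<le> r" and "r \<le> max (charge_max d * lam_c) (discharge_max d * lam_d)"
    using lam unfolding r_def
    by (auto simp: le_max_iff_disj mult.commute[of lam_c] mult.commute[of lam_d] mult_right_mono)
qed

text \<open>Buses without a battery neither charge nor discharge, so they drop out. This is why the
  final bound scales with the number of batteries and not of buses.\<close>

lemma feasible_penalty_eq_sum_batteries:
  assumes valid: "valid_data d" and feas: "feasible d s"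
  shows "(lam_c, lam_d) \<bullet> throughput d (powers_of s) =
    (\<Sum>t\<in>periods d. \<Sum>i\<in>batteries d.
      lam_c * pc (powers_of s) (t, i) + lam_d * pd (powers_of s) (t, i))"
proof -
  have "(\<Sum>i\<in>buses d. lam_c * pc (powers_of s) (t, i) + lam_d * pd (powers_of s) (t, i)) =
    (\<Sum>i\<in>batteries d. lam_c * pc (powers_of s) (t, i) + lam_d * pd (powers_of s) (t, i))"
    if "t \<in> periods d" for t
    using valid feas that
    by (intro sum.mono_neutral_right)
      (auto simp: valid_data_def feasible_def operational_constraints_def
        no_battery_constraints_def Let_def)
  then show ?thesis
    by (simp add: throughput_def sum_distrib_left flip: sum.distrib)
qed

text \<open>The two estimates serve different solutions: the lower one lets the penalty of
  \<open>s_hat\<close> be dropped, the upper one caps that of \<open>s_star\<close>.\<close>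

lemma feasible_penalty_bounds:
  assumes "valid_data d" and "0 \<le> lam_c" and "0 \<le> lam_d" and "feasible d s"
  shows "0 \<le> (lam_c, lam_d) \<bullet> throughput d (powers_of s)"
    and "(lam_c, lam_d) \<bullet> throughput d (powers_of s)
      \<le> real (horizon d) * real (card (batteries d)) *
          max (charge_max d * lam_c) (discharge_max d * lam_d)"
proof -
  let ?M = "max (charge_max d * lam_c) (discharge_max d * lam_d)"
  note eq = feasible_penalty_eq_sum_batteries[OF assms(1,4)]
  note bounds = feasible_battery_penalty_bounds[OF assms]
  show "0 \<le> (lam_c, lam_d) \<bullet> throughput d (powers_of s)"
    unfolding eq by (intro sum_nonneg bounds(1))
  have "(lam_c, lam_d) \<bullet> throughput d (powers_of s) \<le> (\<Sum>t\<in>periods d. \<Sum>i\<in>batteries d. ?M)"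
    unfolding eq by (intro sum_mono bounds(2))
  then show "(lam_c, lam_d) \<bullet> throughput d (powers_of s)
      \<le> real (horizon d) * real (card (batteries d)) * ?M"
    by (simp add: periods_def mult.assoc)
qed

theorem theorem3:
  fixes d :: "'n battery_data"
    and lam_c lam_d :: real
    and s_star s_hat :: "'n solution"
  assumes "valid_data d"
    and "0 \<le> lam_c" and "0 \<le> lam_d"
    and "optimal_battery d s_star"
    and "optimal_reg_battery d (lam_c, lam_d) s_hat"
  shows "total_cost d (powers_of s_hat) - total_cost d (powers_of s_star)
    \<le> real (horizon d) * real (card (batteries d)) *
        max (charge_max d * lam_c) (discharge_max d * lam_d)"
proof -
  have star: "feasible d s_star"
    using assms(4) by (simp add: optimal_battery_def is_arg_min_def)
  have hat: "feasible d s_hat"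
    using assms(5) by (simp add: optimal_reg_battery_def is_arg_min_def)
  \<comment> \<open>Both problems share the set \<open>feasible d\<close>, so \<open>s_star\<close>
    is a competitor of \<open>s_hat\<close> in the regularized problem.\<close>
  have "total_cost d (powers_of s_hat) + (lam_c, lam_d) \<bullet> throughput d (powers_of s_hat)
    \<le> total_cost d (powers_of s_star) + (lam_c, lam_d) \<bullet> throughput d (powers_of s_star)"
    using assms(5) star by (simp only: optimal_reg_battery_def is_arg_min_linorder)
  then show ?thesis
    using feasible_penalty_bounds(1)[OF assms(1-3) hat]
      feasible_penalty_bounds(2)[OF assms(1-3) star]
    by linarith
qed

end
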